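(* Let $f=x^{2}+a_{1}x+a_{0}\in\mathbb{R}[x]$ have no real roots, with non-real roots $re^{\pm i\theta}$, $r>0$, $0<\theta<\pi$, and let $s=\left\lceil \frac{\pi}{\theta}\right\rceil -2$. Write $g_R=\sum_{i=0}^{s} b_i x^i$ for the polynomial $g_R$ defined in the context. Then $$b_{s-j}=r^{j}\cdot\frac{\sin\big((j+1)\theta\big)}{\sin(\theta)}\qquad\text{for } j=0,\ldots,s.$$
   Context: The polynomial $g_R\in\mathbb{R}[x]$ associated with $f=x^2+a_1x+a_0$ is the determinant $g_R=\det M$, where $M=(M_{k,l})_{0\le k,l\le s}$ is the $(s+1)\times(s+1)$ matrix over $\mathbb{R}[x]$ whose last column is $M_{k,s}=x^{k}$ and whose other columns ($0\le l\le s-1$) are given by $M_{l,l}=1$, $M_{l+1,l}=a_1$, $M_{l+2,l}=a_0$ (when $l+2\le s$), and all remaining entries $0$. *)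

theory Defs
  imports Complex_Main "Jordan_Normal_Form.Determinant"
begin

text \<open>
  Rows \<open>k\<close> and columns \<open>l\<close> are indexed from \<open>0\<close> to \<open>s\<close>. The test \<open>l = s\<close> comes first, so the
  banded pattern applies only to the columns \<open>l < s\<close>.
\<close>

definition gR_mat :: "real \<Rightarrow> real \<Rightarrow> nat \<Rightarrow> real poly mat" where
  "gR_mat a1 a0 s = mat (s + 1) (s + 1) (\<lambda>(k, l).
     if l = s then monom 1 k
     else if k = l then 1
     else if k = l + 1 then [:a1:]
     else if k = l + 2 then [:a0:]
     else 0)"

definition gR :: "real \<Rightarrow> real \<Rightarrow> nat \<Rightarrow> real poly" where
  "gR a1 a0 s = det (gR_mat a1 a0 s)"

end

theory Submission
  imports Defs
begin

text \<open>
  The banded columns of \<^term>\<open>gR_mat a1 a0 s\<close> extend to the unit lower triangular Toeplitz matrix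
  \<open>L\<close> with symbol \<open>1 + a1 t + a0 t\<^sup>2\<close>. Solving \<open>L c = (x\<^sup>k)\<^sub>k\<close> factors the matrix as \<open>L\<close> times the
  identity with last column replaced by \<open>c\<close>, so its determinant is the last entry of \<open>c\<close>. The
  coefficients of that entry satisfy a linear recurrence of order two whose characteristic
  polynomial is \<open>f\<close>, and \<open>r\<^sup>j sin ((j + 1) \<theta>) / sin \<theta>\<close> is its solution.
\<close>

text \<open>Forward substitution in \<open>L c = (x^k)\<close>: row \<open>k\<close> gives
  \<open>c_k\<close> from the two entries before it, with rows 0 and 1 cut short by the
  border.\<close>

fun gR_rec :: "real \<Rightarrow> real \<Rightarrow> nat \<Rightarrow> real poly" where
  "gR_rec a1 a0 0 = 1"
| "gR_rec a1 a0 (Suc 0) = monom 1 1 - [:a1:]"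
| "gR_rec a1 a0 (Suc (Suc n)) =
    monom 1 (n + 2) - smult a1 (gR_rec a1 a0 (Suc n)) - smult a0 (gR_rec a1 a0 n)"

definition band_entry :: "real \<Rightarrow> real \<Rightarrow> nat \<Rightarrow> nat \<Rightarrow> real poly" where
  "band_entry a1 a0 k l =
    (if k = l then 1 else if k = l + 1 then [:a1:] else if k = l + 2 then [:a0:] else 0)"

lemma sum_band_entry:
  assumes "k < n"
  shows "(\<Sum>i<n. band_entry a1 a0 k i * gR_rec a1 a0 i) = monom 1 k"
proof -
  let ?c = "gR_rec a1 a0"
  \<comment> \<open>Three indicator terms, one per diagonal, so that each sum collapses to at most
    one entry; \<open>Suc i = k\<close> avoids truncated subtraction when
    \<open>k < 2\<close>.\<close>
  have split: "band_entry a1 a0 k i * ?c i =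
      (if i = k then ?c i else 0) + (if Suc i = k then smult a1 (?c i) else 0)
      + (if Suc (Suc i) = k then smult a0 (?c i) else 0)" for i
    by (auto simp: band_entry_def)
  show ?thesis
    unfolding split sum.distrib
    using assms by (cases "(a1, a0, k)" rule: gR_rec.cases) (auto simp: monom_0 one_pCons)
qed

lemma gR_eq_gR_rec: "gR a1 a0 s = gR_rec a1 a0 s"
proof -
  define L where "L = mat (s + 1) (s + 1) (\<lambda>(k, l). band_entry a1 a0 k l)"
  define N where "N = mat (s + 1) (s + 1)
    (\<lambda>(k, l). if l = s then gR_rec a1 a0 k else if k = l then 1 else 0)"
  have carrier: "L \<in> carrier_mat (s + 1) (s + 1)" "N \<in> carrier_mat (s + 1) (s + 1)"
    by (auto simp: L_def N_def)
  have "gR_mat a1 a0 s = L * N"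
  proof (rule eq_matI)
    fix k l
    assume "k < dim_row (L * N)" "l < dim_col (L * N)"
    then have k: "k < s + 1" and l: "l < s + 1"
      by (auto simp: L_def N_def)
    have prod: "(L * N) $$ (k, l) = (\<Sum>i<s + 1. band_entry a1 a0 k i *
        (if l = s then gR_rec a1 a0 i else if i = l then 1 else 0))"
      using k l by (simp add: L_def N_def scalar_prod_def atLeast0LessThan del: sum.lessThan_Suc)
    show "gR_mat a1 a0 s $$ (k, l) = (L * N) $$ (k, l)"
    \<comment> \<open>Column \<open>s\<close> of \<open>N\<close> is \<open>c\<close>, which
      \<open>L\<close> maps to the powers of x; every other column is a unit vector and picks out a
      column of \<open>L\<close>.\<close>
    proof (cases "l = s")
      case True
      then show ?thesis
        using prod sum_band_entry[OF k] k by (simp add: gR_mat_def del: sum.lessThan_Suc)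
    next
      case False
      have "(\<Sum>i<s + 1. band_entry a1 a0 k i * (if i = l then 1 else 0)) = band_entry a1 a0 k l"
        using l by (simp add: if_distrib[of "(*) _"] del: sum.lessThan_Suc cong: if_cong)
      then show ?thesis
        using prod k l False by (simp add: gR_mat_def band_entry_def del: sum.lessThan_Suc)
    qed
  qed (auto simp: gR_mat_def L_def N_def)
  moreover have "det L = 1"
    by (subst det_lower_triangular[OF _ carrier(1)])
      (auto simp: L_def band_entry_def prod_list_diag_prod)
  moreover have "upper_triangular N"
    by (auto simp: N_def)
  then have "det N = gR_rec a1 a0 s"
    by (subst det_upper_triangular[OF _ carrier(2)]) (auto simp: N_def prod_list_diag_prod)
  ultimately show ?thesis
    using det_mult[OF carrier] by (simp add: gR_def)
qed

text \<open>The inverse of \<open>L\<close> is again Toeplitz, with entries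
  \<open>h (n - i)\<close>, where \<open>h\<close> lists the power series coefficients of
  \<open>1 / (1 + a1 t + a0 t^2)\<close>.\<close>

lemma coeff_gR_rec:
  fixes h :: "nat \<Rightarrow> real"
  assumes "h 0 = 1" "h 1 = - a1" and h: "\<And>n. h (n + 2) = - a1 * h (n + 1) - a0 * h n"
  shows "coeff (gR_rec a1 a0 n) i = (if i \<le> n then h (n - i) else 0)"
proof (induction n arbitrary: i rule: induct_nat_012)
  case 0
  then show ?case
    using assms(1) by simp
next
  case 1
  then show ?case
    using assms(1,2) by (cases i) auto
next
  case (ge2 n)
  \<comment> \<open>The remaining indices \<open>n + 1\<close> and \<open>n + 2\<close> rest on the
    initial values \<open>h 1\<close> and \<open>h 0\<close>.\<close>
  have "h (Suc (Suc n) - i) = - a1 * h (Suc n - i) - a0 * h (n - i)" if "i \<le> n"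
    using h[of "n - i"] that by (simp add: Suc_diff_le)
  then show ?case
    using ge2 assms(1,2) by (auto simp: le_Suc_eq)
qed

text \<open>This is \<open>sin (u + \<theta>) + sin (u - \<theta>) = 2 * cos \<theta> * sin
  u\<close> at \<open>u = (n + 2) * \<theta>\<close>, scaled by
  \<open>r ^ (n + 2) / sin \<theta>\<close>.\<close>

lemma sin_ratio_recurrence:
  fixes r \<theta> :: real
  defines "h \<equiv> \<lambda>j. r ^ j * (sin (real (j + 1) * \<theta>) / sin \<theta>)"
  shows "h (n + 2) = 2 * r * cos \<theta> * h (n + 1) - r\<^sup>2 * h n"
proof -
  define u where "u = real (n + 2) * \<theta>"
  have "sin (real (n + 3) * \<theta>) + sin (real (n + 1) * \<theta>) = sin (u + \<theta>) + sin (u - \<theta>)"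
    by (simp add: u_def algebra_simps)
  also have "\<dots> = 2 * cos \<theta> * sin u"
    by (simp add: sin_add sin_diff)
  finally have "sin (real (n + 3) * \<theta>) = 2 * cos \<theta> * sin (real (n + 2) * \<theta>) - sin (real (n + 1) * \<theta>)"
    by (simp add: u_def)
  moreover have "real (n + 2 + 1) = real (n + 3)" "real (n + 1 + 1) = real (n + 2)"
    by simp_all
  ultimately show ?thesis
    unfolding h_def by (simp only:) (simp add: power_add power2_eq_square diff_divide_distrib algebra_simps)
qed

text \<open>One non-real root suffices: the imaginary part, divided by
  \<open>r * sin \<theta>\<close>, gives \<open>a1\<close>, and then the real part gives
  \<open>a0\<close>.\<close>

lemma quadratic_coeffs_of_rcis_root:
  fixes a1 a0 r \<theta> :: real
  assumes root: "poly (map_poly complex_of_real [:a0, a1, 1:]) (rcis r \<theta>) = 0"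
    and "r > 0" "sin \<theta> \<noteq> 0"
  shows "a1 = - 2 * r * cos \<theta>" "a0 = r\<^sup>2"
proof -
  have "of_real a0 + rcis r \<theta> * (of_real a1 + rcis r \<theta>) = 0"
    using root by (simp add: map_poly_pCons)
  then have re: "a0 + r * cos \<theta> * (a1 + r * cos \<theta>) - r * sin \<theta> * (r * sin \<theta>) = 0"
    and im: "r * cos \<theta> * (r * sin \<theta>) + r * sin \<theta> * (a1 + r * cos \<theta>) = 0"
    by (simp_all add: complex_eq_iff)
  from im have "r * sin \<theta> * (a1 + 2 * r * cos \<theta>) = 0"
    by (simp add: algebra_simps)
  then show a1: "a1 = - 2 * r * cos \<theta>"
    using assms by simp
  have "a0 = r\<^sup>2 * ((cos \<theta>)\<^sup>2 + (sin \<theta>)\<^sup>2)"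
    using re unfolding a1
    by (simp add: power2_eq_square algebra_simps del: sin_cos_squared_add2 sin_cos_squared_add3)
  then show "a0 = r\<^sup>2"
    by simp
qed

theorem theorem5:
  fixes a1 a0 r \<theta> :: real and f :: "real poly" and s :: nat
  assumes "f = [:a0, a1, 1:]"
    and "\<not> (\<exists>x. poly f x = 0)"
    and "r > 0" and "0 < \<theta>" and "\<theta> < pi"
    and "{z. poly (map_poly complex_of_real f) z = 0} = {rcis r \<theta>, rcis r (- \<theta>)}"
    and "int s = \<lceil>pi / \<theta>\<rceil> - 2"
  shows "degree (gR a1 a0 s) \<le> s \<and>
    (\<forall>j\<le>s. coeff (gR a1 a0 s) (s - j) = r ^ j * (sin (real (j + 1) * \<theta>) / sin \<theta>))"
proof -
  have sin: "sin \<theta> \<noteq> 0"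
    using sin_gt_zero[OF assms(4,5)] by simp
  have "poly (map_poly complex_of_real [:a0, a1, 1:]) (rcis r \<theta>) = 0"
    using assms(1,6) by blast
  note a = quadratic_coeffs_of_rcis_root[OF this assms(3) sin]
  define h where "h j = r ^ j * (sin (real (j + 1) * \<theta>) / sin \<theta>)" for j
  have "h 0 = 1"
    using sin by (simp add: h_def)
  moreover have "h 1 = - a1"
    \<comment> \<open>Here
      \<open>r * sin (2 * \<theta>) / sin \<theta> = 2 * r * cos \<theta>\<close>.\<close>
    using sin sin_double[of \<theta>] by (simp add: h_def a(1))
  moreover have "h (n + 2) = - a1 * h (n + 1) - a0 * h n" for n
    using sin_ratio_recurrence[of r n \<theta>] by (simp add: h_def a)
  ultimately have coeff: "coeff (gR a1 a0 s) i = (if i \<le> s then h (s - i) else 0)" for i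
    unfolding gR_eq_gR_rec by (rule coeff_gR_rec)
  have "degree (gR a1 a0 s) \<le> s"
    by (rule degree_le) (simp add: coeff)
  then show ?thesis
    by (simp add: coeff h_def)
qed

end
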